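(* Let $B=\mathbb{F}_q$, $F=\mathbb{F}_{q^\ell}$ with $\ell>1$, let $\mathcal{A}$ be a $d$-dimensional $B$-linear subspace of $F$, and let $n=q^d$. Then the I/O cost (with respect to any basis of $F$ over $B$) of any linear repair scheme over $B$ for any node of ${\rm RS}(\mathcal{A},q^d-2)$ satisfies $$\gamma_{I/O}\ \geq\ (n-1)\ell-(\ell-d+1)q^{d-1}.$$
   Context: ${\rm Tr}_{F/B}$ is the trace from $F$ to $B$. For $\mathcal{A}=\{\alpha_1,\dots,\alpha_n\}\subseteq F$ (distinct elements) and $1\le k<n$, ${\rm RS}(\mathcal{A},k)=\{(f(\alpha_1),\dots,f(\alpha_n)): f\in F[x],\ \deg f\le k-1\}$; coordinate $i$ is called node $i$. When $\mathcal{A}$ is a $B$-linear subspace of $F$, ${\rm RS}(\mathcal{A},k)^\perp={\rm RS}(\mathcal{A},n-k)$. A linear repair scheme (over $B$) for node $i^*$ of ${\rm RS}(\mathcal{A},k)$ is a list of $\ell$ polynomials $g_1,\dots,g_\ell\in F[x]$ of degree less than $n-k$ such that $g_1(\alpha_{i^*}),\dots,g_\ell(\alpha_{i^*})$ are linearly independent over $B$. Given a basis $\mathcal{B}=\{\beta^{(1)},\dots,\beta^{(\ell)}\}$ of $F$ over $B$, for $i\in\{1,\dots,n\}$ let $W_i$ be the $\ell\times\ell$ matrix over $B$ whose $(j,s)$ entry is ${\rm Tr}_{F/B}(g_j(\alpha_i)\beta^{(s)})$. The I/O cost with respect to $\mathcal{B}$ is $\gamma_{I/O}=\sum_{i=1}^n{\rm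 nz}(W_i)-\ell=\sum_{i\ne i^*}{\rm nz}(W_i)$, where ${\rm nz}(W)$ is the number of nonzero columns of $W$. *)

theory Defs
  imports
    "HOL-Library.Cardinality"
    "HOL-Computational_Algebra.Computational_Algebra"
    "Jordan_Normal_Form.Matrix"
begin

text \<open>An extension \<open>F/B\<close> of finite fields is given by two types \<open>'a\<close> (for \<open>F\<close>) and \<open>'b\<close> (for \<open>B\<close>)
  and a field homomorphism \<open>emb :: 'b \<Rightarrow> 'a\<close>, which is the inclusion of \<open>B\<close> in \<open>F\<close>.
  The \<open>B\<close>-linear notions on \<open>F\<close> are those of the library for the following scalar multiplication.\<close>

definition ext_scale :: "('b::field \<Rightarrow> 'a::field) \<Rightarrow> 'b \<Rightarrow> 'a \<Rightarrow> 'a" where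
  "ext_scale emb c x = emb c * x"

definition ext_degree :: "('b::field \<Rightarrow> 'a::field) \<Rightarrow> nat" where
  "ext_degree emb = vector_space.dim (ext_scale emb) UNIV"

text \<open>The trace of finite fields, \<open>Tr(x) = x + x\<^sup>q + x^(q^2) + \<dots> + x^(q^(l-1))\<close> with \<open>q = |B|\<close>
  and \<open>l = [F : B]\<close>. This sum is always in the image of \<open>B\<close> (lemma \<open>emb_ext_trace\<close> below),
  so that it can be pulled back to \<open>'b\<close>.\<close>

definition ext_trace :: "('b::finite_field \<Rightarrow> 'a::finite_field) \<Rightarrow> 'a \<Rightarrow> 'b" where
  "ext_trace emb x = the_inv emb (\<Sum>i<ext_degree emb. x ^ (CARD('b) ^ i))"

text \<open>A finite family of elements of \<open>F\<close> is linearly independent over \<open>B\<close>; unlike for a set,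
  repetitions in the list make it dependent.\<close>

definition lin_indpt_list :: "('b::field \<Rightarrow> 'a::field) \<Rightarrow> 'a list \<Rightarrow> bool" where
  "lin_indpt_list emb xs \<longleftrightarrow>
     distinct xs \<and> module.independent (ext_scale emb) (set xs)"

definition ordered_basis :: "('b::field \<Rightarrow> 'a::field) \<Rightarrow> 'a list \<Rightarrow> bool" where
  "ordered_basis emb \<beta>s \<longleftrightarrow>
     lin_indpt_list emb \<beta>s \<and> module.span (ext_scale emb) (set \<beta>s) = UNIV"

text \<open>The evaluation points \<open>\<alpha> 1, \<dots>, \<alpha> n\<close> of a code \<open>RS(A, k)\<close> are distinct, and \<open>1 \<le> k < n\<close>.
  Besides these data, the code itself plays no role in the definition of a linear repair scheme.\<close>

definition rs_parameters :: "nat \<Rightarrow> (nat \<Rightarrow> 'a) \<Rightarrow> nat \<Rightarrow> bool" where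
  "rs_parameters n \<alpha> k \<longleftrightarrow> inj_on \<alpha> {1..n} \<and> 1 \<le> k \<and> k < n"

text \<open>As \<open>n - k > 0\<close> for the codes above, the condition \<open>degree g < n - k\<close> allows the zero
  polynomial, whose degree is 0 in the library.\<close>

definition linear_repair_scheme ::
  "('b::field \<Rightarrow> 'a::field) \<Rightarrow> nat \<Rightarrow> (nat \<Rightarrow> 'a) \<Rightarrow> nat \<Rightarrow> nat \<Rightarrow> 'a poly list \<Rightarrow> bool" where
  "linear_repair_scheme emb n \<alpha> k i gs \<longleftrightarrow>
     rs_parameters n \<alpha> k \<and> i \<in> {1..n} \<and>
     length gs = ext_degree emb \<and>
     (\<forall>g \<in> set gs. degree g < n - k) \<and>
     lin_indpt_list emb (map (\<lambda>g. poly g (\<alpha> i)) gs)"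

definition repair_matrix ::
  "('b::finite_field \<Rightarrow> 'a::finite_field) \<Rightarrow> 'a list \<Rightarrow> 'a poly list \<Rightarrow> 'a \<Rightarrow> 'b mat" where
  "repair_matrix emb \<beta>s gs x =
     mat (length gs) (length \<beta>s) (\<lambda>(j, s). ext_trace emb (poly (gs ! j) x * \<beta>s ! s))"

definition nz :: "'b::zero mat \<Rightarrow> nat" where
  "nz W = card {s. s < dim_col W \<and> col W s \<noteq> 0\<^sub>v (dim_row W)}"

definition io_cost ::
  "('b::finite_field \<Rightarrow> 'a::finite_field) \<Rightarrow> nat \<Rightarrow> (nat \<Rightarrow> 'a) \<Rightarrow> 'a list \<Rightarrow> 'a poly list \<Rightarrow> int" where
  "io_cost emb n \<alpha> \<beta>s gs =
     (\<Sum>i = 1..n. int (nz (repair_matrix emb \<beta>s gs (\<alpha> i)))) - int (ext_degree emb)"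


lemma vector_space_ext_scale:
  assumes "field_hom emb"
  shows "vector_space (ext_scale emb)"
proof -
  interpret field_hom emb by fact
  show ?thesis
    by unfold_locales (auto simp: ext_scale_def algebra_simps hom_distribs)
qed

lemma card_eq_power_ext_degree:
  fixes emb :: "'b::finite_field \<Rightarrow> 'a::finite_field"
  assumes "field_hom emb"
  shows "CARD('a) = CARD('b) ^ ext_degree emb"
proof -
  interpret vector_space "ext_scale emb" by (rule vector_space_ext_scale) fact
  obtain X where X: "independent X" "UNIV \<subseteq> span X" "card X = dim UNIV"
    by (rule basis_exists[of UNIV])
  have fin: "finite X" by simp
  let ?f = "\<lambda>u. \<Sum>v\<in>X. ext_scale emb (u v) v"
  have "inj_on ?f (X \<rightarrow>\<^sub>E UNIV)"
  proof (rule inj_onI)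
    fix u w assume uw: "u \<in> X \<rightarrow>\<^sub>E UNIV" "w \<in> X \<rightarrow>\<^sub>E UNIV" "?f u = ?f w"
    have "(\<Sum>v\<in>X. ext_scale emb (u v - w v) v) = 0"
      using uw(3) by (simp add: scale_left_diff_distrib sum_subtractf)
    hence "u v - w v = 0" if "v \<in> X" for v
      using independentD[OF X(1) fin, of "\<lambda>v. u v - w v" v] that by auto
    thus "u = w" using uw(1,2) by (intro PiE_ext) auto
  qed
  moreover have "?f ` (X \<rightarrow>\<^sub>E UNIV) = UNIV"
  proof -
    have "y \<in> ?f ` (X \<rightarrow>\<^sub>E UNIV)" for y
    proof -
      have "y \<in> span X" using X(2) by auto
      then obtain u where "y = ?f u" unfolding span_finite[OF fin] by (rule rangeE)
      hence "y = ?f (restrict u X)" by simp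
      moreover have "restrict u X \<in> X \<rightarrow>\<^sub>E UNIV" by simp
      ultimately show ?thesis by (rule image_eqI)
    qed
    thus ?thesis by auto
  qed
  ultimately have "CARD('a) = card (X \<rightarrow>\<^sub>E (UNIV :: 'b set))"
    using card_image[of ?f "X \<rightarrow>\<^sub>E UNIV"] by simp
  thus ?thesis
    using X(3) by (simp add: card_PiE ext_degree_def)
qed

lemma add_power_card_base:
  fixes emb :: "'b::finite_field \<Rightarrow> 'a::finite_field" and x y :: 'a
  assumes "field_hom emb"
  shows "(x + y) ^ CARD('b) = x ^ CARD('b) + y ^ CARD('b)"
proof -
  interpret h: field_hom emb by fact
  let ?q = "CARD('b)"
  have q: "?q > 1"
    using card_mono[of UNIV "{0::'b, 1}"] by simp
  define P :: "'b poly" where "P = (\<Sum>k\<in>{1..<?q}. monom (of_nat (?q choose k)) k)"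
  have binom: "(x + 1) ^ ?q = x ^ ?q + 1 + (\<Sum>k\<in>{1..<?q}. of_nat (?q choose k) * x ^ k)"
    for x :: "'c::comm_ring_1"
  proof -
    have "{..?q} = insert 0 (insert ?q {1..<?q})" using q by auto
    thus ?thesis using q unfolding binomial_ring[of x 1 ?q] by simp
  qed
  have "poly P x = 0" for x
    using binom[of x]
    by (simp add: P_def poly_sum poly_monom finite_field_power_card_eq_same)
  moreover have "degree P < ?q"
    unfolding P_def using q
    by (intro degree_sum_less) (auto intro: le_less_trans[OF degree_monom_le])
  ultimately have "P = 0"
    by (intro poly_eqI_degree[of UNIV P 0]) auto
  have "of_nat (?q choose k) = (0::'a)" if "k \<in> {1..<?q}" for k
  proof -
    have "coeff P k = of_nat (?q choose k)"
      using that by (simp add: P_def coeff_sum)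
    hence "of_nat (?q choose k) = (0::'b)" using \<open>P = 0\<close> by simp
    from arg_cong[OF this, of emb] show ?thesis by (simp only: hom_distribs h.hom_zero)
  qed
  hence one: "(x + 1) ^ ?q = x ^ ?q + 1" for x :: 'a
    using binom[of x] by simp
  show ?thesis
  proof (cases "y = 0")
    case False
    have "x + y = y * (x / y + 1)"
      using False by (simp add: distrib_left)
    hence "(x + y) ^ ?q = y ^ ?q * (x / y + 1) ^ ?q"
      by (simp only: power_mult_distrib)
    also have "\<dots> = x ^ ?q + y ^ ?q"
      using False by (simp add: one power_divide distrib_left)
    finally show ?thesis .
  qed (use q in \<open>simp add: power_0_left\<close>)
qed

lemma power_card_base_eq_imp_range:
  fixes emb :: "'b::finite_field \<Rightarrow> 'a::finite_field"
  assumes "field_hom emb" and "x ^ CARD('b) = x"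
  shows "x \<in> range emb"
proof -
  interpret h: field_hom emb by fact
  let ?q = "CARD('b)"
  have q: "?q > 1"
    using card_mono[of UNIV "{0::'b, 1}"] by simp
  define P :: "'a poly" where "P = monom 1 ?q - monom 1 1"
  have ev: "poly P y = y ^ ?q - y" for y by (simp add: P_def poly_monom)
  have "coeff P ?q = 1" using q by (simp add: P_def)
  hence "P \<noteq> 0" by auto
  have "degree P \<le> ?q"
    unfolding P_def using q
    by (intro degree_diff_le) (auto intro: order.trans[OF degree_monom_le])
  have sub: "range emb \<subseteq> {y. poly P y = 0}"
    by (auto simp: ev finite_field_power_card_eq_same simp flip: h.hom_power)
  have "card {y. poly P y = 0} \<le> ?q"
    using card_poly_roots_bound[OF \<open>P \<noteq> 0\<close>] \<open>degree P \<le> ?q\<close> by linarith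
  moreover have "card (range emb) = ?q"
    by (simp add: card_image h.inj_f)
  ultimately have "range emb = {y. poly P y = 0}"
    by (intro card_seteq[OF _ sub]) auto
  thus ?thesis using assms(2) by (simp add: ev)
qed

lemma emb_ext_trace:
  fixes emb :: "'b::finite_field \<Rightarrow> 'a::finite_field"
  assumes "field_hom emb"
  shows "emb (ext_trace emb x) = (\<Sum>i<ext_degree emb. x ^ (CARD('b) ^ i))"
proof -
  interpret h: field_hom emb by fact
  let ?q = "CARD('b)" and ?l = "ext_degree emb"
  define t where "t = (\<Sum>i<?l. x ^ (?q ^ i))"
  have sum_pow: "(\<Sum>i<n. f i) ^ ?q = (\<Sum>i<n. f i ^ ?q)" for n and f :: "nat \<Rightarrow> 'a"
    by (induction n) (auto simp: add_power_card_base[OF assms] power_0_left)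
  have "t ^ ?q = (\<Sum>i<?l. x ^ (?q ^ Suc i))"
    unfolding t_def sum_pow by (simp add: power_mult[symmetric] mult.commute)
  also have "\<dots> = t"
  proof -
    have "x ^ (?q ^ ?l) = x"
      using finite_field_power_card_eq_same[of x] card_eq_power_ext_degree[OF assms] by simp
    moreover have "t + x ^ (?q ^ ?l) = x + (\<Sum>i<?l. x ^ (?q ^ Suc i))"
      using sum.lessThan_Suc[of "\<lambda>i. x ^ (?q ^ i)" ?l]
        sum.lessThan_Suc_shift[of "\<lambda>i. x ^ (?q ^ i)" ?l] by (simp add: t_def)
    ultimately show ?thesis by (simp add: add.commute)
  qed
  finally have "t \<in> range emb"
    by (rule power_card_base_eq_imp_range[OF assms])
  thus ?thesis
    unfolding ext_trace_def t_def[symmetric] by (rule f_the_inv_into_f[OF h.inj_f])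
qed

end

theory Submission
  imports Defs
begin

text \<open>The polynomials of the scheme are affine: \<open>g(x) = g(a) + u\<^sub>g (x - a)\<close> where \<open>a\<close> is the
  failed node. Let \<open>R z w\<close> mean \<open>Tr(u\<^sub>g z + g(a) w) = 0\<close> for all \<open>g\<close>. As the \<open>g(a)\<close> span \<open>F\<close> and
  the trace form is nondegenerate, \<open>R\<close> is a linear partial map \<open>z \<mapsto> w\<close>, and the column of the basis
  element \<open>b\<close> vanishes at the node \<open>a + y\<close> iff \<open>R (y b) b\<close>. For fixed \<open>b\<close> the solutions \<open>y \<in> A\<close> form
  an affine subspace missing \<open>0\<close>, so there are at most \<open>q^(d-1)\<close> of them, and at most as many as
  elements of the kernel of \<open>R\<close>. If \<open>t\<close> basis elements admit a solution, they lie in the range of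
  \<open>R\<close>, hence the kernel has at most \<open>q^(l-t)\<close> elements. So the number of zero columns is at most
  \<open>t * min(q^(d-1), q^(l-t))\<close>, which never exceeds \<open>(l - d + 1) q^(d-1)\<close>.\<close>

section \<open>Linearity and nondegeneracy of the trace form\<close>

lemma add_power_card_base_power:
  fixes emb :: "'b::finite_field \<Rightarrow> 'a::finite_field" and x y :: 'a
  assumes "field_hom emb"
  shows "(x + y) ^ (CARD('b) ^ i) = x ^ (CARD('b) ^ i) + y ^ (CARD('b) ^ i)"
  by (induction i) (auto simp: power_mult power_Suc2 add_power_card_base[OF assms] simp del: power_Suc)

lemma finite_field_power_card_power_eq_same:
  "(c :: 'b::finite_field) ^ (CARD('b) ^ i) = c"
  by (induction i) (auto simp: power_mult finite_field_power_card_eq_same)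

text \<open>After applying the injective \<open>emb\<close>, the trace becomes a sum of powers
  x^(q^j), each of which is additive.\<close>

lemma ext_trace_add:
  assumes "field_hom emb"
  shows "ext_trace emb (x + y) = ext_trace emb x + ext_trace emb y"
proof -
  interpret h: field_hom emb by fact
  have "emb (ext_trace emb (x + y)) = emb (ext_trace emb x + ext_trace emb y)"
    by (simp add: h.hom_add emb_ext_trace[OF assms] add_power_card_base_power[OF assms]
        sum.distrib)
  thus ?thesis by simp
qed

lemma ext_trace_scale:
  assumes "field_hom emb"
  shows "ext_trace emb (emb c * x) = c * ext_trace emb x"
proof -
  interpret h: field_hom emb by fact
  have "emb (ext_trace emb (emb c * x)) = emb (c * ext_trace emb x)"
    by (simp add: h.hom_mult emb_ext_trace[OF assms] power_mult_distrib sum_distrib_left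
        finite_field_power_card_power_eq_same flip: h.hom_power)
  thus ?thesis by simp
qed

lemma ext_trace_0 [simp]:
  assumes "field_hom emb"
  shows "ext_trace emb 0 = 0"
  using ext_trace_add[OF assms, of 0 0] by (metis add.right_neutral add_left_cancel)

lemma card_finite_field_gt_1: "CARD('b::finite_field) > 1"
  using card_mono[of UNIV "{0::'b, 1}"] by simp

text \<open>The trace is evaluation of the sum of X^(q^j) over j < l. This polynomial has degree
  less than q^l = |F| and coefficient 1 at X, so it cannot vanish on all of F.\<close>

lemma ext_trace_nonzero:
  fixes emb :: "'b::finite_field \<Rightarrow> 'a::finite_field"
  assumes "field_hom emb"
  shows "\<exists>x. ext_trace emb x \<noteq> 0"
proof (rule ccontr)
  assume "\<not> ?thesis"
  hence Tr: "ext_trace emb x = 0" for x by simp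
  interpret h: field_hom emb by fact
  let ?q = "CARD('b)" and ?l = "ext_degree emb"
  have q: "?q > 1" by (rule card_finite_field_gt_1)
  have l: "?l > 0"
    using card_eq_power_ext_degree[OF assms] card_finite_field_gt_1[where 'b='a]
    by (cases ?l) auto
  define P :: "'a poly" where "P = (\<Sum>i<?l. monom 1 (?q ^ i))"
  have "poly P x = 0" for x
    using emb_ext_trace[OF assms, of x] Tr[of x] by (simp add: P_def poly_sum poly_monom)
  moreover have "degree P < CARD('a)"
    unfolding P_def card_eq_power_ext_degree[OF assms] using q
    by (intro degree_sum_less) (auto intro: le_less_trans[OF degree_monom_le])
  ultimately have "P = 0"
    by (intro poly_eqI_degree[of UNIV P 0]) auto
  moreover have "coeff P 1 = (\<Sum>i<?l. if i = 0 then 1 else 0)"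
    unfolding P_def coeff_sum using q by (intro sum.cong) auto
  ultimately show False using l by simp
qed

lemma ext_trace_nondegenerate:
  assumes "field_hom emb" and "\<And>x. ext_trace emb (x * w) = 0"
  shows "w = 0"
proof (rule ccontr)
  assume w: "w \<noteq> 0"
  obtain x where "ext_trace emb x \<noteq> 0" using ext_trace_nonzero[OF assms(1)] by blast
  thus False using assms(2)[of "x / w"] w by simp
qed

section \<open>Bases of F over B\<close>

lemma ordered_basis_length:
  fixes emb :: "'b::finite_field \<Rightarrow> 'a::finite_field"
  assumes "field_hom emb" "ordered_basis emb \<beta>s"
  shows "length \<beta>s = ext_degree emb"
proof -
  interpret vector_space "ext_scale emb" by (rule vector_space_ext_scale) fact
  show ?thesis
    using assms(2) dim_eq_card[of "set \<beta>s" UNIV]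
    by (auto simp: ordered_basis_def lin_indpt_list_def ext_degree_def distinct_card)
qed

text \<open>Meant for the values g(a) at the failed node, which a repair scheme only assumes to be
  independent.\<close>

lemma lin_indpt_list_span:
  fixes emb :: "'b::finite_field \<Rightarrow> 'a::finite_field"
  assumes "field_hom emb" "lin_indpt_list emb xs" "length xs = ext_degree emb"
  shows "module.span (ext_scale emb) (set xs) = UNIV"
proof -
  interpret vector_space "ext_scale emb" by (rule vector_space_ext_scale) fact
  obtain X where X: "independent X" "UNIV \<subseteq> span X"
    by (rule basis_exists[of UNIV])
  interpret finite_dimensional_vector_space "ext_scale emb" X
    by unfold_locales (use X in auto)
  have "UNIV \<subseteq> span (set xs)"
    using assms by (intro card_ge_dim_independent)
      (auto simp: lin_indpt_list_def ext_degree_def distinct_card)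
  thus ?thesis by auto
qed

section \<open>Numerical estimate\<close>

text \<open>Let c = l - d + 1. If t \<le> c, the first bound on N suffices. If t = c + m, then t
  \<le> c (m + 1) \<le> c q^m, and the second bound finishes since q^m q^(l-t) = q^(d-1).\<close>

lemma mult_power_le:
  fixes q :: nat
  assumes "q \<ge> 2" "1 \<le> d" "d \<le> l" "t \<le> l" "N \<le> q ^ (d - 1)" "N \<le> q ^ (l - t)"
  shows "t * N \<le> (l - d + 1) * q ^ (d - 1)"
proof (cases "t \<le> l - d + 1")
  case True
  thus ?thesis using assms by (intro mult_le_mono)
next
  case False
  define m where "m = t - (l - d + 1)"
  let ?c = "l - d + 1"
  have t: "t = ?c + m" and e: "d - 1 = m + (l - t)"
    using False assms by (auto simp: m_def)
  have "Suc m \<le> 2 ^ m" by (simp add: Suc_leI)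
  also have "\<dots> \<le> q ^ m" using assms(1) by (intro power_mono) auto
  finally have "?c * Suc m \<le> ?c * q ^ m" by (intro mult_le_mono) auto
  hence "t \<le> ?c * q ^ m" using t by simp
  hence "t * N \<le> (?c * q ^ m) * q ^ (l - t)"
    using assms(6) by (intro mult_le_mono)
  thus ?thesis by (simp only: e power_add mult.assoc)
qed

section \<open>Counting for linear partial maps\<close>

text \<open>\<open>R\<close> is the graph of a B-linear map. With a graph, no value has to be
  constructed for each z; single-valuedness is asked at 0 and spreads by linearity in
  \<open>R_unique\<close>.\<close>

locale linear_partial_map = field_hom emb
  for emb :: "'b::finite_field \<Rightarrow> 'a::finite_field" +
  fixes R :: "'a \<Rightarrow> 'a \<Rightarrow> bool"
  assumes R_add: "R z w \<Longrightarrow> R z' w' \<Longrightarrow> R (z + z') (w + w')"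
    and R_scale: "R z w \<Longrightarrow> R (emb c * z) (emb c * w)"
    and R_zero: "R 0 0"
    and R_functional: "R 0 w \<Longrightarrow> w = 0"
begin

sublocale ext: vector_space "ext_scale emb"
  by (rule vector_space_ext_scale) (rule field_hom_axioms)

lemma R_diff: "R z w \<Longrightarrow> R z' w' \<Longrightarrow> R (z - z') (w - w')"
  using R_add[of z w "- z'" "- w'"] R_scale[of z' w' "- 1"] by (simp add: hom_uminus)

lemma R_unique: "R z w \<Longrightarrow> R z w' \<Longrightarrow> w = w'"
  using R_diff[of z w z w'] R_functional[of "w - w'"] by simp

lemma R_sum: "(\<And>x. x \<in> I \<Longrightarrow> R (f x) (g x)) \<Longrightarrow> R (sum f I) (sum g I)"
  by (induction I rule: infinite_finite_induct) (auto intro: R_add R_zero)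

definition fixers :: "'a set \<Rightarrow> 'a \<Rightarrow> 'a set" where
  "fixers A b = {y \<in> A. R (y * b) b}"

definition ker :: "'a set" where
  "ker = {z. R z 0}"

text \<open>For two solutions y and y0, both y b and y0 b are sent to b, so their difference lies in
  the kernel.\<close>

lemma card_fixers_le_ker:
  assumes "b \<noteq> 0"
  shows "card (fixers A b) \<le> card ker"
proof (cases "fixers A b = {}")
  case False
  then obtain y0 where y0: "y0 \<in> fixers A b" by blast
  show ?thesis
  proof (rule card_inj_on_le[of "\<lambda>y. y * b - y0 * b"])
    show "inj_on (\<lambda>y. y * b - y0 * b) (fixers A b)"
      using assms by (auto intro: inj_onI)
    show "(\<lambda>y. y * b - y0 * b) ` fixers A b \<subseteq> ker"
      using y0 R_diff by (force simp: fixers_def ker_def)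
  qed auto
qed auto

text \<open>For a fixed solution y0, the q translates of the solution set by multiples -c y0 lie in
  A and are disjoint: (y - c y0) b is sent to (1 - c) b, which determines c.\<close>

lemma card_fixers_le_subspace:
  assumes "b \<noteq> 0" "ext.subspace A"
  shows "CARD('b) * card (fixers A b) \<le> card A"
proof (cases "fixers A b = {}")
  case False
  then obtain y0 where y0: "y0 \<in> A" "R (y0 * b) b" by (auto simp: fixers_def)
  let ?f = "\<lambda>(c, y). y - emb c * y0"
  have val: "R (?f (c, y) * b) (emb (1 - c) * b)" if "y \<in> fixers A b" for c y
    using R_diff[of "y * b" b "emb c * (y0 * b)" "emb c * b"] R_scale[OF y0(2), of c] that
    by (simp add: fixers_def hom_minus algebra_simps)
  have "card ((UNIV :: 'b set) \<times> fixers A b) \<le> card A"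
  proof (rule card_inj_on_le[of ?f])
    show "inj_on ?f (UNIV \<times> fixers A b)"
    proof (rule inj_onI)
      fix p p' assume p: "p \<in> UNIV \<times> fixers A b" "p' \<in> UNIV \<times> fixers A b" "?f p = ?f p'"
      obtain c y c' y' where [simp]: "p = (c, y)" "p' = (c', y')" by (metis surj_pair)
      have "emb (1 - c) * b = emb (1 - c') * b"
        using p val[of y c] val[of y' c'] by (intro R_unique[of "?f p * b"]) auto
      hence "c = c'" using assms by simp
      thus "p = p'" using p(3) by simp
    qed
    have "y - emb c * y0 \<in> A" if "y \<in> A" for c y
      using assms(2) that y0(1) ext.subspace_diff[of A y "emb c * y0"]
        ext.subspace_scale[of A y0 c] by (simp add: ext_scale_def)
    thus "?f ` (UNIV \<times> fixers A b) \<subseteq> A"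
      by (auto simp: fixers_def)
  qed auto
  thus ?thesis by (simp add: card_cartesian_product)
qed auto

text \<open>Rank-nullity as a count: each b in \<open>I\<close> has a preimage y b. Combinations of
  these preimages plus kernel elements are pairwise distinct, since the image gives back the
  coefficients by independence, and then the kernel element is determined.\<close>

lemma card_ker_bound:
  assumes "ext.independent I" "\<And>b. b \<in> I \<Longrightarrow> fixers A b \<noteq> {}"
  shows "CARD('b) ^ card I * card ker \<le> CARD('a)"
proof -
  from assms(2) have "\<forall>b\<in>I. \<exists>y. R (y * b) b" by (fastforce simp: fixers_def)
  then obtain y where y: "\<And>b. b \<in> I \<Longrightarrow> R (y b * b) b" by metis
  let ?f = "\<lambda>(u, k). (\<Sum>b\<in>I. emb (u b) * (y b * b)) + k"
  have val: "R (?f (u, k)) (\<Sum>b\<in>I. emb (u b) * b)" if "k \<in> ker" for u k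
  proof -
    have "R (\<Sum>b\<in>I. emb (u b) * (y b * b)) (\<Sum>b\<in>I. emb (u b) * b)"
      by (intro R_sum R_scale y)
    thus ?thesis using R_add[of _ _ k 0] that by (force simp: ker_def)
  qed
  have "card ((I \<rightarrow>\<^sub>E (UNIV :: 'b set)) \<times> ker) \<le> CARD('a)"
  proof (rule card_inj_on_le[of ?f])
    show "inj_on ?f ((I \<rightarrow>\<^sub>E UNIV) \<times> ker)"
    proof (rule inj_onI)
      fix p p' assume p: "p \<in> (I \<rightarrow>\<^sub>E UNIV) \<times> ker" "p' \<in> (I \<rightarrow>\<^sub>E UNIV) \<times> ker" "?f p = ?f p'"
      obtain u k u' k' where [simp]: "p = (u, k)" "p' = (u', k')" by (metis surj_pair)
      have "(\<Sum>b\<in>I. emb (u b) * b) = (\<Sum>b\<in>I. emb (u' b) * b)"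
        using p val[of k u] val[of k' u'] by (intro R_unique[of "?f p"]) auto
      hence "(\<Sum>b\<in>I. ext_scale emb (u b - u' b) b) = 0"
        by (simp add: ext_scale_def hom_minus left_diff_distrib sum_subtractf)
      hence "u b = u' b" if "b \<in> I" for b
        using ext.independentD[OF assms(1), of I "\<lambda>b. u b - u' b" b] that by auto
      hence "u = u'" using p(1,2) by (intro PiE_ext[of u I _ u']) auto
      thus "p = p'" using p(3) by simp
    qed
  qed auto
  thus ?thesis by (simp add: card_cartesian_product card_PiE)
qed

text \<open>Only the t basis elements with a solution contribute, each at most the smaller of the
  two bounds. The second claim makes the truncated difference in the first one exact.\<close>

lemma sum_card_fixers_le:
  assumes X: "ext.independent X" "card X = ext_degree emb"
    and A: "ext.subspace A" "card A = CARD('b) ^ d" "d \<ge> 1"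
  shows "(\<Sum>b\<in>X. card (fixers A b)) \<le> (ext_degree emb - d + 1) * CARD('b) ^ (d - 1)"
    and "d \<le> ext_degree emb"
proof -
  let ?q = "CARD('b)" and ?l = "ext_degree emb"
  have q: "?q > 1" by (rule card_finite_field_gt_1)
  have F: "CARD('a) = ?q ^ ?l" by (rule card_eq_power_ext_degree) (rule field_hom_axioms)
  have "?q ^ d \<le> ?q ^ ?l"
    using card_mono[of UNIV A] A(2) F by simp
  thus d: "d \<le> ?l" using q by simp
  define I where "I = {b \<in> X. fixers A b \<noteq> {}}"
  define t where "t = card I"
  define N where "N = min (card ker) (?q ^ (d - 1))"
  have t: "t \<le> ?l"
    unfolding t_def X(2)[symmetric] by (intro card_mono) (auto simp: I_def)
  have "ext.independent I"
    by (rule ext.independent_mono[OF X(1)]) (auto simp: I_def)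
  hence "?q ^ t * card ker \<le> CARD('a)"
    unfolding t_def by (rule card_ker_bound[of I A]) (auto simp: I_def)
  also have "CARD('a) = ?q ^ t * ?q ^ (?l - t)"
    using t F by (metis le_add_diff_inverse power_add)
  finally have K: "card ker \<le> ?q ^ (?l - t)" using q by simp
  have "card (fixers A b) \<le> N" if "b \<in> I" for b
  proof -
    have b: "b \<noteq> 0" using that X(1) ext.dependent_zero by (auto simp: I_def)
    have "?q * card (fixers A b) \<le> ?q * ?q ^ (d - 1)"
      using card_fixers_le_subspace[OF b A(1)] A(2,3) by (metis power_eq_if not_one_le_zero)
    hence "card (fixers A b) \<le> ?q ^ (d - 1)" using q by simp
    thus ?thesis using card_fixers_le_ker[OF b, of A] by (simp add: N_def)
  qed
  hence "(\<Sum>b\<in>I. card (fixers A b)) \<le> t * N"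
    using sum_bounded_above[of I "\<lambda>b. card (fixers A b)" N] by (simp add: t_def)
  also have "\<dots> \<le> (?l - d + 1) * ?q ^ (d - 1)"
    using q d t K A(3) by (intro mult_power_le) (auto simp: N_def)
  also have "(\<Sum>b\<in>I. card (fixers A b)) = (\<Sum>b\<in>X. card (fixers A b))"
    by (intro sum.mono_neutral_left) (auto simp: I_def)
  finally show "(\<Sum>b\<in>X. card (fixers A b)) \<le> (?l - d + 1) * ?q ^ (d - 1)" .
qed

end

section \<open>Zero columns of the repair matrices\<close>

text \<open>Distinctness allows zero columns to be counted by basis elements instead of
  indices.\<close>

lemma nz_repair_matrix:
  assumes "distinct \<beta>s"
  shows "nz (repair_matrix emb \<beta>s gs x) +
    card {b \<in> set \<beta>s. \<forall>g\<in>set gs. ext_trace emb (poly g x * b) = 0} = length \<beta>s"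
proof -
  let ?W = "repair_matrix emb \<beta>s gs x"
  let ?P = "\<lambda>b. \<forall>g\<in>set gs. ext_trace emb (poly g x * b) = 0"
  have col: "col ?W s = 0\<^sub>v (dim_row ?W) \<longleftrightarrow> ?P (\<beta>s ! s)" if "s < length \<beta>s" for s
    using that by (auto simp: repair_matrix_def vec_eq_iff all_set_conv_all_nth)
  have "bij_betw ((!) \<beta>s) {s. s < length \<beta>s \<and> ?P (\<beta>s ! s)} {b \<in> set \<beta>s. ?P b}"
    using assms by (auto simp: bij_betw_def inj_on_def nth_eq_iff_index_eq in_set_conv_nth)
  hence "card {b \<in> set \<beta>s. ?P b} = card {s. s < length \<beta>s \<and> ?P (\<beta>s ! s)}"
    by (simp add: bij_betw_same_card)
  moreover have "nz ?W = card {s. s < length \<beta>s \<and> \<not> ?P (\<beta>s ! s)}"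
    unfolding nz_def using col by (intro arg_cong[of _ _ card]) (auto simp: repair_matrix_def)
  moreover have "card {s. s < length \<beta>s \<and> \<not> ?P (\<beta>s ! s)} + card {s. s < length \<beta>s \<and> ?P (\<beta>s ! s)}
      = card ({s. s < length \<beta>s \<and> \<not> ?P (\<beta>s ! s)} \<union> {s. s < length \<beta>s \<and> ?P (\<beta>s ! s)})"
    by (intro card_Un_disjoint[symmetric]) auto
  moreover have "{s. s < length \<beta>s \<and> \<not> ?P (\<beta>s ! s)} \<union> {s. s < length \<beta>s \<and> ?P (\<beta>s ! s)}
      = {..<length \<beta>s}" by auto
  ultimately show ?thesis by simp
qed

lemma poly_degree_le_1:
  fixes g :: "'a::comm_ring_1 poly"
  assumes "degree g \<le> 1"
  shows "poly g x = poly g a + coeff g 1 * (x - a)"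
proof -
  have "{..(1::nat)} = {0, 1}" by auto
  hence "poly g z = coeff g 0 + coeff g 1 * z" for z
    using arg_cong[OF poly_as_sum_of_monoms'[OF assms], of "\<lambda>p. poly p z"]
    by (simp add: poly_monom)
  thus ?thesis by (simp add: algebra_simps)
qed

theorem theorem13:
  fixes emb :: "'b::finite_field \<Rightarrow> 'a::finite_field"
    and \<alpha> :: "nat \<Rightarrow> 'a" and A :: "'a set" and \<beta>s :: "'a list" and gs :: "'a poly list"
    and q l d n i :: nat
  assumes "field_hom emb"
    and "CARD('b) = q" and "CARD('a) = q ^ l" and "l > 1"
    and "module.subspace (ext_scale emb) A" and "vector_space.dim (ext_scale emb) A = d"
    and "n = q ^ d"
    and "bij_betw \<alpha> {1..n} A"
    and "ordered_basis emb \<beta>s"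
    and "linear_repair_scheme emb n \<alpha> (q ^ d - 2) i gs"
  shows "io_cost emb n \<alpha> \<beta>s gs
           \<ge> (int n - 1) * int l - (int l - int d + 1) * int q ^ (d - 1)"
proof -
  note emb = assms(1) and n = assms(7)
  have q: "q > 1" using card_finite_field_gt_1[where 'b='b] assms(2) by simp
  have l: "ext_degree emb = l"
    using card_eq_power_ext_degree[OF emb] assms(2,3) q by simp
  have scheme: "1 \<le> q ^ d - 2" "i \<in> {1..n}" "length gs = l"
      "\<And>g. g \<in> set gs \<Longrightarrow> degree g < n - (q ^ d - 2)"
      "lin_indpt_list emb (map (\<lambda>g. poly g (\<alpha> i)) gs)"
    using assms(10) l by (auto simp: linear_repair_scheme_def rs_parameters_def)
  \<comment> \<open>For d = 0 the truncated q^d - 2 would be 0.\<close>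
  have d: "d \<ge> 1" using scheme(1) by (cases d) auto
  \<comment> \<open>Here q^d - 2 is not truncated, so n - k = 2.\<close>
  have deg: "degree g \<le> 1" if "g \<in> set gs" for g
    using scheme(4)[OF that] scheme(1) n by linarith
  have cardA: "card A = q ^ d"
    using bij_betw_same_card[OF assms(8)] n by simp
  have a: "\<alpha> i \<in> A" using assms(8) scheme(2) by (auto simp: bij_betw_def)
  define R where "R z w \<longleftrightarrow> (\<forall>g\<in>set gs. ext_trace emb (coeff g 1 * z + poly g (\<alpha> i) * w) = 0)"
    for z w
  interpret linear_partial_map emb R
  proof (intro linear_partial_map.intro linear_partial_map_axioms.intro)
    show "field_hom emb" by fact
    show "R (z + z') (w + w')" if "R z w" "R z' w'" for z w z' w'
    proof -
      have "coeff g 1 * (z + z') + poly g (\<alpha> i) * (w + w')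
        = (coeff g 1 * z + poly g (\<alpha> i) * w) + (coeff g 1 * z' + poly g (\<alpha> i) * w')" for g
        by (simp add: algebra_simps)
      thus ?thesis using that by (auto simp: R_def ext_trace_add[OF emb])
    qed
    show "R (emb c * z) (emb c * w)" if "R z w" for c z w
    proof -
      have "coeff g 1 * (emb c * z) + poly g (\<alpha> i) * (emb c * w)
        = emb c * (coeff g 1 * z + poly g (\<alpha> i) * w)" for g
        by (simp add: algebra_simps)
      thus ?thesis using that by (auto simp: R_def ext_trace_scale[OF emb])
    qed
    show "R 0 0" by (simp add: R_def emb)
    show "w = 0" if "R 0 w" for w
    proof (rule ext_trace_nondegenerate[OF emb])
      interpret vector_space "ext_scale emb" by (rule vector_space_ext_scale) fact
      fix x
      \<comment> \<open>At z = 0 the relation says Tr(g(a) w) = 0 for all g; this extends to every x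
        because the g(a) span F.\<close>
      have "x \<in> span (set (map (\<lambda>g. poly g (\<alpha> i)) gs))"
        using lin_indpt_list_span[OF emb scheme(5)] scheme(3) l by simp
      thus "ext_trace emb (x * w) = 0"
      proof (induction rule: span_induct_alt)
        case (step c y z)
        have "(ext_scale emb c y + z) * w = emb c * (y * w) + z * w"
          by (simp add: ext_scale_def algebra_simps)
        moreover have "ext_trace emb (y * w) = 0" using step(1) that by (auto simp: R_def)
        ultimately show ?case
          using step by (simp add: ext_trace_add[OF emb] ext_trace_scale[OF emb])
      qed (simp add: emb)
    qed
  qed
  have \<beta>: "distinct \<beta>s" "ext.independent (set \<beta>s)" "length \<beta>s = l"
    using assms(9) ordered_basis_length[OF emb assms(9)] l
    by (auto simp: ordered_basis_def lin_indpt_list_def)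
  let ?Z = "\<lambda>x b. \<forall>g\<in>set gs. ext_trace emb (poly g x * b) = 0"
  have Z: "?Z x b \<longleftrightarrow> R ((x - \<alpha> i) * b) b" for x b
  proof -
    have "poly g x * b = coeff g 1 * ((x - \<alpha> i) * b) + poly g (\<alpha> i) * b" if "g \<in> set gs" for g
      unfolding poly_degree_le_1[OF deg[OF that], of x "\<alpha> i"] by (simp add: algebra_simps)
    thus ?thesis by (simp add: R_def)
  qed
  have fix_card: "card {x \<in> A. ?Z x b} = card (fixers A b)" for b
  proof -
    \<comment> \<open>Translation by the failed node preserves A, as that node lies in A.\<close>
    have "bij_betw (\<lambda>x. x - \<alpha> i) {x \<in> A. ?Z x b} (fixers A b)"
      unfolding Z fixers_def
      by (rule bij_betwI[of _ _ _ "\<lambda>y. y + \<alpha> i"])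
        (use a assms(5) in \<open>auto intro: ext.subspace_diff ext.subspace_add\<close>)
    thus ?thesis by (rule bij_betw_same_card)
  qed
  let ?nz = "\<lambda>x. nz (repair_matrix emb \<beta>s gs x)"
  \<comment> \<open>Double counting: the zero columns are summed per basis element on the left and
    regrouped per node, where zero and nonzero columns add up to l.\<close>
  have "(\<Sum>j = 1..n. ?nz (\<alpha> j)) + (\<Sum>b\<in>set \<beta>s. card (fixers A b))
      = (\<Sum>x\<in>A. ?nz x) + (\<Sum>b\<in>set \<beta>s. card {x \<in> A. ?Z x b})"
    using sum.reindex_bij_betw[OF assms(8), of ?nz] by (simp add: fix_card)
  also have "(\<Sum>b\<in>set \<beta>s. card {x \<in> A. ?Z x b}) = (\<Sum>x\<in>A. card {b \<in> set \<beta>s. ?Z x b})"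
    by (rule sum_multicount_gen) auto
  also have "(\<Sum>x\<in>A. ?nz x) + \<dots> = n * l"
    using nz_repair_matrix[OF \<beta>(1), of emb gs] \<beta>(3) cardA n by (simp flip: sum.distrib)
  finally have "int (\<Sum>j = 1..n. ?nz (\<alpha> j)) = int n * int l - int (\<Sum>b\<in>set \<beta>s. card (fixers A b))"
    by (metis add_diff_cancel_right' of_nat_add of_nat_mult)
  \<comment> \<open>The l subtracted in \<open>io_cost\<close> turns n l into (n - 1) l.\<close>
  hence io: "io_cost emb n \<alpha> \<beta>s gs = (int n - 1) * int l - int (\<Sum>b\<in>set \<beta>s. card (fixers A b))"
    by (simp add: io_cost_def l algebra_simps)
  have bound: "(\<Sum>b\<in>set \<beta>s. card (fixers A b)) \<le> (l - d + 1) * q ^ (d - 1)" and dl: "d \<le> l"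
    using sum_card_fixers_le[of "set \<beta>s" A d] \<beta> assms(2,5) cardA d l distinct_card[of \<beta>s]
    by auto
  have "int (\<Sum>b\<in>set \<beta>s. card (fixers A b)) \<le> int (l - d + 1) * int q ^ (d - 1)"
    using bound by (simp only: of_nat_le_iff flip: of_nat_power of_nat_mult)
  also have "int (l - d + 1) = int l - int d + 1" using dl by simp
  finally show ?thesis using io by simp
qed

end
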